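(* Let $d^A_0,d^A_1,d^B_0,d^B_1\ge 1$ be integers and let $\mathcal{P}$ be the two-input no-signalling polytope with output numbers $d^A_X$ (Alice, input $X\in\{0,1\}$) and $d^B_Y$ (Bob, input $Y\in\{0,1\}$). The non-local vertices of $\mathcal{P}$ are exactly the boxes in $\mathcal{P}$ that are equivalent, under reversible local relabelling, to the box $$p_{ab|XY}=\begin{cases}1/k & \text{if } a,b\in\{0,\ldots,k-1\}\text{ and }(b-a)\bmod k = X\cdot Y,\\ 0&\text{otherwise,}\end{cases}$$ for some $k\in\{2,\ldots,\min_{X,Y}(d^A_X,d^B_Y)\}$; each such $k$ occurs.
   Context: A (bipartite, two-input, non-signalling) box with output numbers $d^A_X,d^B_Y$ is a family of real numbers $p_{ab|XY}$, with $X,Y\in\{0,1\}$, $a\in\{0,\ldots,d^A_X-1\}$, $b\in\{0,\ldots,d^B_Y-1\}$, satisfying: positivity $p_{ab|XY}\ge 0$; normalization $\sum_{a,b}p_{ab|XY}=1$ for all $X,Y$; no-signalling: $\sum_b p_{ab|XY}$ does not depend on $Y$ (for all $a,X$) and $\sum_a p_{ab|XY}$ does not depend on $X$ (for all $b,Y$). The set $\mathcal{P}$ of all such boxes is a convex polytope; its vertices are its extreme points. A box is local if it can be written $p_{ab|XY}=\sum_\lambda p_\lambda\,p_{a|X}(\lambda)\,p_{b|Y}(\lambda)$ (finite sum), where $(p_\lambda)$ is a probability distribution and, for each $\lambda$, $p_{\cdot|X}(\lambda)$ and $p_{\cdot|Y}(\lambda)$ are probability distributions on Alice's outputs for input $X$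 and Bob's outputs for input $Y$. Otherwise it is non-local. Reversible local relabelling: each party may permute their inputs and, conditionally on the input, permute their outputs. That is, $p$ is equivalent to $q$ if there are permutations $\sigma,\tau$ of $\{0,1\}$ and, for each $X$ and $Y$, permutations $\pi_X$ of $\{0,\ldots,d^A_X-1\}$ and $\rho_Y$ of $\{0,\ldots,d^B_Y-1\}$ with $p_{ab|XY}=q_{\pi_X(a)\,\rho_Y(b)\,|\,\sigma(X)\tau(Y)}$ for all $a,b,X,Y$. (The displayed box is regarded as being defined for all non-negative integers $a,b$, with value $0$ outside $\{0,\ldots,k-1\}$.) *)

theory Defs
  imports "HOL-Analysis.Analysis" "HOL-Analysis.Finite_Function_Topology"
begin

(* A family p_{ab|XY} is a finitely supported function on index tuples (a, b, X, Y); finitely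
   supported functions form a real vector space, so the library's extreme_point_of applies. *)
type_synonym box = "(nat \<times> nat \<times> nat \<times> nat) \<Rightarrow>\<^sub>0 real"

definition prob :: "box \<Rightarrow> nat \<Rightarrow> nat \<Rightarrow> nat \<Rightarrow> nat \<Rightarrow> real" where
  "prob p a b X Y = Poly_Mapping.lookup p (a, b, X, Y)"

(* dA X and dB Y are the output numbers; only their values at the inputs 0 and 1 matter.
   The support condition makes an element of box carry no data beyond the family of the
   p_{ab|XY} with a < dA X, b < dB Y and X, Y in {0, 1}. Without it no element would be extreme. *)
definition ns_polytope :: "(nat \<Rightarrow> nat) \<Rightarrow> (nat \<Rightarrow> nat) \<Rightarrow> box set" where
  "ns_polytope dA dB = {p.
     (\<forall>a b X Y. prob p a b X Y \<noteq> 0 \<longrightarrow> X \<in> {0, 1} \<and> Y \<in> {0, 1} \<and> a < dA X \<and> b < dB Y) \<and>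
     (\<forall>X\<in>{0, 1}. \<forall>Y\<in>{0, 1}. \<forall>a<dA X. \<forall>b<dB Y. prob p a b X Y \<ge> 0) \<and>
     (\<forall>X\<in>{0, 1}. \<forall>Y\<in>{0, 1}. (\<Sum>a<dA X. \<Sum>b<dB Y. prob p a b X Y) = 1) \<and>
     (\<forall>X\<in>{0, 1}. \<forall>a<dA X. \<forall>Y\<in>{0, 1}. \<forall>Y'\<in>{0, 1}.
        (\<Sum>b<dB Y. prob p a b X Y) = (\<Sum>b<dB Y'. prob p a b X Y')) \<and>
     (\<forall>Y\<in>{0, 1}. \<forall>b<dB Y. \<forall>X\<in>{0, 1}. \<forall>X'\<in>{0, 1}.
        (\<Sum>a<dA X. prob p a b X Y) = (\<Sum>a<dA X'. prob p a b X' Y))}"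

definition prob_vector :: "nat \<Rightarrow> (nat \<Rightarrow> real) \<Rightarrow> bool" where
  "prob_vector n w \<longleftrightarrow> (\<forall>i<n. w i \<ge> 0) \<and> (\<Sum>i<n. w i) = 1"

(* w l, pA l X a and pB l Y b stand for p_lambda, p_{a|X}(lambda) and p_{b|Y}(lambda). *)
definition local_box :: "(nat \<Rightarrow> nat) \<Rightarrow> (nat \<Rightarrow> nat) \<Rightarrow> box \<Rightarrow> bool" where
  "local_box dA dB p \<longleftrightarrow>
     (\<exists>(n::nat) (w :: nat \<Rightarrow> real) (pA :: nat \<Rightarrow> nat \<Rightarrow> nat \<Rightarrow> real) (pB :: nat \<Rightarrow> nat \<Rightarrow> nat \<Rightarrow> real).
        prob_vector n w \<and>
        (\<forall>l<n. \<forall>X\<in>{0, 1}. prob_vector (dA X) (pA l X)) \<and>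
        (\<forall>l<n. \<forall>Y\<in>{0, 1}. prob_vector (dB Y) (pB l Y)) \<and>
        (\<forall>X\<in>{0, 1}. \<forall>Y\<in>{0, 1}. \<forall>a<dA X. \<forall>b<dB Y.
           prob p a b X Y = (\<Sum>l<n. w l * pA l X a * pB l Y b)))"

(* The second family q is given on all non-negative integers a, b, because sigma and tau may
   exchange inputs with different output numbers. *)
definition relabelling_equivalent ::
    "(nat \<Rightarrow> nat) \<Rightarrow> (nat \<Rightarrow> nat) \<Rightarrow> box \<Rightarrow> (nat \<Rightarrow> nat \<Rightarrow> nat \<Rightarrow> nat \<Rightarrow> real) \<Rightarrow> bool" where
  "relabelling_equivalent dA dB p q \<longleftrightarrow>
     (\<exists>\<sigma> \<tau> (\<pi> :: nat \<Rightarrow> nat \<Rightarrow> nat) (\<rho> :: nat \<Rightarrow> nat \<Rightarrow> nat).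
        \<sigma> permutes {0, 1} \<and> \<tau> permutes {0, 1} \<and>
        (\<forall>X\<in>{0, 1}. \<pi> X permutes {..<dA X}) \<and>
        (\<forall>Y\<in>{0, 1}. \<rho> Y permutes {..<dB Y}) \<and>
        (\<forall>X\<in>{0, 1}. \<forall>Y\<in>{0, 1}. \<forall>a<dA X. \<forall>b<dB Y.
           prob p a b X Y = q (\<pi> X a) (\<rho> Y b) (\<sigma> X) (\<tau> Y)))"

definition pr_family :: "nat \<Rightarrow> nat \<Rightarrow> nat \<Rightarrow> nat \<Rightarrow> nat \<Rightarrow> real" where
  "pr_family k a b X Y =
     (if a < k \<and> b < k \<and> (int b - int a) mod int k = int (X * Y) then 1 / real k else 0)"

end

theory Submission
  imports Defs
begin

text \<open>
  Arrange the outcomes in four layers \<open>B\<^sub>1, A\<^sub>0, B\<^sub>0, A\<^sub>1\<close> (one per party and input), closed up cyclically.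
  The four input pairs are exactly the pairs of consecutive layers, so the numbers \<open>p\<^bsub>ab|XY\<^esub>\<close> are weights
  on the edges between consecutive layers, and no-signalling says that inflow equals outflow at every
  outcome. A box is thus a circulation of total flow 1, and the extreme circulations are the uniform
  ones on simple directed cycles: the support of any circulation contains such a cycle, and a
  circulation supported on a cycle is constant along it. A cycle that winds \<open>k\<close> times around
  visits \<open>k\<close> outcomes of each layer. Numbering these along the cycle, starting in
  \<open>B\<^sub>1\<close>, turns three of the four matchings into \<open>b = a\<close> and the one from \<open>A\<^sub>1\<close> to \<open>B\<^sub>1\<close> into
  \<open>b = a + 1\<close> modulo \<open>k\<close>. For \<open>k = 1\<close> the box is deterministic; for \<open>k \<ge> 2\<close> it is non-local because a
  deterministic strategy in its support would close up after a single turn.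
\<close>

subsection \<open>Finite combinatorics\<close>

lemma shift_mod_inj:
  fixes i j k n :: nat
  assumes "i < k" "j < k" "(i + n) mod k = (j + n) mod k"
  shows "i = j"
  using assms
proof (induction i j rule: linorder_wlog)
  case (le i j)
  then have "k dvd (j + n) - (i + n)" by (simp only: mod_eq_dvd_iff_nat[symmetric] add_le_mono1)
  then have "k dvd j - i" by simp
  then show ?case using le by (auto dest: dvd_imp_le)
qed simp

text \<open>A shift modulo \<open>k\<close> is an injective self-map of \<open>{..<k}\<close>, hence
  onto, so each \<open>j < k\<close> has exactly one preimage. With \<open>n = X * Y\<close> this
  evaluates Bob's marginals of a cycle box.\<close>

lemma sum_shift_mod_indicator:
  fixes k d n j :: nat
  assumes "0 < k" "k \<le> d"
  shows "(\<Sum>i<d. if i < k \<and> j = (i + n) mod k then (c::real) else 0) = (if j < k then c else 0)"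
proof (cases "j < k")
  case True
  have "inj_on (\<lambda>i. (i + n) mod k) {..<k}"
    by (intro inj_onI) (metis shift_mod_inj lessThan_iff)
  then have "(\<lambda>i. (i + n) mod k) ` {..<k} = {..<k}"
    using assms(1) by (intro endo_inj_surj) auto
  then have "j \<in> (\<lambda>i. (i + n) mod k) ` {..<k}" using True by blast
  then obtain i where i: "i < k" "j = (i + n) mod k" by blast
  have "(\<Sum>i'<d. if i' < k \<and> j = (i' + n) mod k then c else 0) = (\<Sum>i'<d. if i' = i then c else 0)"
    using i shift_mod_inj by (intro sum.cong refl if_cong) metis+
  then show ?thesis using i assms True by (simp add: sum.delta)
next
  case False
  then show ?thesis using assms(1) by (auto intro!: sum.neutral)
qed

text \<open>The image of \<open>f\<close> and \<open>{..<k}\<close> have equally large complements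
  in \<open>{..<d}\<close>, so any bijection between these completes the inverse of
  \<open>f\<close>. This turns a numbering of the outcomes on a cycle into a relabelling of all
  outcomes, including those that the cycle misses.\<close>

lemma inj_extends_to_permutation:
  fixes f :: "nat \<Rightarrow> nat"
  assumes inj: "inj_on f {..<k}" and range: "f ` {..<k} \<subseteq> {..<d}"
  obtains \<pi> where "\<pi> permutes {..<d}" "\<And>i. i < k \<Longrightarrow> \<pi> (f i) = i"
proof -
  have kd: "k \<le> d" using card_inj_on_le[OF inj range] by simp
  have "card ({..<d} - f ` {..<k}) = card ({..<d} - {..<k})"
    using kd range by (simp add: card_Diff_subset card_image[OF inj])
  then obtain h where h: "bij_betw h ({..<d} - f ` {..<k}) ({..<d} - {..<k})"
    using finite_same_card_bij by (metis finite_Diff finite_lessThan)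
  define \<pi> where "\<pi> a = (if a \<in> f ` {..<k} then inv_into {..<k} f a else if a < d then h a else a)" for a
  have "bij_betw (inv_into {..<k} f) (f ` {..<k}) {..<k}"
    using inj by (simp add: bij_betw_inv_into inj_on_imp_bij_betw)
  then have "bij_betw \<pi> (f ` {..<k}) {..<k}"
    by (subst bij_betw_cong[of _ _ "inv_into {..<k} f"]) (auto simp: \<pi>_def)
  moreover have "bij_betw \<pi> ({..<d} - f ` {..<k}) ({..<d} - {..<k})"
    using h by (subst bij_betw_cong[of _ _ h]) (auto simp: \<pi>_def)
  ultimately have "bij_betw \<pi> (f ` {..<k} \<union> ({..<d} - f ` {..<k})) ({..<k} \<union> ({..<d} - {..<k}))"
    by (rule bij_betw_combine) auto
  moreover have "f ` {..<k} \<union> ({..<d} - f ` {..<k}) = {..<d}" "{..<k} \<union> ({..<d} - {..<k}) = {..<d}"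
    using range kd by auto
  ultimately have "\<pi> permutes {..<d}"
    using range by (intro bij_imp_permutes) (auto simp: \<pi>_def)
  moreover have "\<pi> (f i) = i" if "i < k" for i
    using that inj by (simp add: \<pi>_def inv_into_f_f)
  ultimately show ?thesis by (rule that)
qed

text \<open>An orbit in a finite set repeats a value. From that value on it is periodic, and taking
  the least period makes the points of one period distinct.\<close>

lemma exists_periodic_point:
  assumes fin: "finite S" and S: "x \<in> S" "\<And>y. y \<in> S \<Longrightarrow> F y \<in> S"
  obtains y k where "y \<in> S" "0 < (k::nat)" "(F ^^ k) y = y" "inj_on (\<lambda>i. (F ^^ i) y) {..<k}"
proof -
  have inS: "(F ^^ i) y \<in> S" if "y \<in> S" for i y
    using that S(2) by (induction i) auto
  have "\<not> inj (\<lambda>i. (F ^^ i) x)"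
    using inS[OF S(1)] fin by (metis finite_imageD finite_subset image_subsetI infinite_UNIV_nat)
  then obtain i j where ij: "i < j" "(F ^^ i) x = (F ^^ j) x"
    unfolding inj_def by (metis linorder_neqE_nat)
  define y where "y = (F ^^ i) x"
  define P where "P n \<longleftrightarrow> 0 < n \<and> (F ^^ n) y = y" for n
  have "F ^^ j = F ^^ ((j - i) + i)" using ij(1) by simp
  then have "(F ^^ (j - i)) y = y" unfolding y_def using ij by (simp only: funpow_add o_apply)
  then have "P (j - i)" using ij(1) by (simp add: P_def)
  define k where "k = (LEAST n. P n)"
  have k: "P k" unfolding k_def by (rule LeastI) fact
  have least: "k \<le> n" if "P n" for n unfolding k_def using that by (rule Least_le)
  \<comment> \<open>Applying \<open>F\<close> another \<open>k - b\<close> times to both sides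
    yields a return to \<open>y\<close> after \<open>k - b + a\<close> steps, fewer than the least
    period \<open>k\<close>.\<close>
  have noloop: False if "a < b" "b < k" "(F ^^ a) y = (F ^^ b) y" for a b
  proof -
    have "(F ^^ (k - b + a)) y = (F ^^ (k - b)) ((F ^^ b) y)"
      using that(3) by (simp add: funpow_add)
    also have "\<dots> = (F ^^ (k - b + b)) y" by (simp only: funpow_add o_apply)
    also have "\<dots> = y" using that k by (simp add: P_def)
    finally have "P (k - b + a)" using that by (simp add: P_def)
    then show False using least that by fastforce
  qed
  show ?thesis
  proof (rule that)
    show "y \<in> S" unfolding y_def using inS S(1) .
    show "0 < k" "(F ^^ k) y = y" using k by (auto simp: P_def)
    show "inj_on (\<lambda>i. (F ^^ i) y) {..<k}"
      using noloop by (intro inj_onI) (metis lessThan_iff linorder_neqE_nat)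
  qed
qed

text \<open>Solves the congruence for \<open>b\<close>, so that each input pair becomes a matching
  given by a shift. This needs \<open>X * Y < k\<close>, which is where \<open>2 \<le> k\<close>
  enters.\<close>

lemma pr_family_eq:
  assumes "2 \<le> k" "X \<in> {0,1}" "Y \<in> {0,1}"
  shows "pr_family k a b X Y = (if a < k \<and> b = (a + X * Y) mod k then 1 / real k else 0)"
proof -
  have "b < k \<and> (int b - int a) mod int k = int (X * Y) \<longleftrightarrow> b = (a + X * Y) mod k" if "a < k"
  proof
    assume *: "b < k \<and> (int b - int a) mod int k = int (X * Y)"
    have "int ((a + X * Y) mod k) = (int a + (int b - int a) mod int k) mod int k"
      using * by (simp add: zmod_int)
    also have "\<dots> = int b" unfolding mod_add_right_eq using * by simp
    finally show "b = (a + X * Y) mod k" by simp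
  next
    assume *: "b = (a + X * Y) mod k"
    have "(int b - int a) mod int k = (int a + int (X * Y) - int a) mod int k"
      unfolding * by (simp only: zmod_int mod_diff_left_eq of_nat_add)
    also have "\<dots> = int (X * Y)" using assms by auto
    finally show "b < k \<and> (int b - int a) mod int k = int (X * Y)" using * assms by simp
  qed
  then show ?thesis unfolding pr_family_def by auto
qed

subsection \<open>Boxes and the no-signalling polytope\<close>

lemma ns_polytopeD:
  assumes "p \<in> ns_polytope dA dB"
  shows ns_support: "prob p a b X Y \<noteq> 0 \<Longrightarrow> X \<in> {0,1} \<and> Y \<in> {0,1} \<and> a < dA X \<and> b < dB Y"
    and ns_nonneg: "0 \<le> prob p a b X Y"
    and ns_total: "\<lbrakk>X \<in> {0,1}; Y \<in> {0,1}\<rbrakk> \<Longrightarrow> (\<Sum>a<dA X. \<Sum>b<dB Y. prob p a b X Y) = 1"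
    and ns_Alice: "\<lbrakk>X \<in> {0,1}; Y \<in> {0,1}; Y' \<in> {0,1}\<rbrakk> \<Longrightarrow>
           (\<Sum>b<dB Y. prob p a b X Y) = (\<Sum>b<dB Y'. prob p a b X Y')"
    and ns_Bob: "\<lbrakk>Y \<in> {0,1}; X \<in> {0,1}; X' \<in> {0,1}\<rbrakk> \<Longrightarrow>
           (\<Sum>a<dA X. prob p a b X Y) = (\<Sum>a<dA X'. prob p a b X' Y)"
proof -
  show supp: "X \<in> {0,1} \<and> Y \<in> {0,1} \<and> a < dA X \<and> b < dB Y" if "prob p a b X Y \<noteq> 0" for a b X Y
    using assms that unfolding ns_polytope_def by blast
  show "0 \<le> prob p a b X Y"
  proof (cases "prob p a b X Y = 0")
    case False
    from supp[OF this] assms show ?thesis unfolding ns_polytope_def by blast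
  qed simp
  show "(\<Sum>a<dA X. \<Sum>b<dB Y. prob p a b X Y) = 1" if "X \<in> {0,1}" "Y \<in> {0,1}"
    using assms that unfolding ns_polytope_def by blast
  show "(\<Sum>b<dB Y. prob p a b X Y) = (\<Sum>b<dB Y'. prob p a b X Y')"
    if "X \<in> {0,1}" "Y \<in> {0,1}" "Y' \<in> {0,1}"
  proof (cases "a < dA X")
    case True
    with assms that show ?thesis unfolding ns_polytope_def by blast
  next
    case False
    then have "prob p a b X Y = 0" for b Y using supp by blast
    then show ?thesis by simp
  qed
  show "(\<Sum>a<dA X. prob p a b X Y) = (\<Sum>a<dA X'. prob p a b X' Y)"
    if "Y \<in> {0,1}" "X \<in> {0,1}" "X' \<in> {0,1}"
  proof (cases "b < dB Y")
    case True
    with assms that show ?thesis unfolding ns_polytope_def by blast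
  next
    case False
    then have "prob p a b X Y = 0" for a X using supp by blast
    then show ?thesis by simp
  qed
qed

lemma lookup_scaleR:
  fixes p :: "'a \<Rightarrow>\<^sub>0 real"
  shows "Poly_Mapping.lookup (r *\<^sub>R p) i = r * Poly_Mapping.lookup p i"
proof -
  have "finite {i. r *\<^sub>R Poly_Mapping.lookup p i \<noteq> 0}"
    by (rule finite_subset[OF _ finite_lookup[of p]]) auto
  then show ?thesis by (simp add: scaleR_poly_mapping_def)
qed

lemma prob_linear [simp]:
  "prob (p + q) a b X Y = prob p a b X Y + prob q a b X Y"
  "prob (r *\<^sub>R p) a b X Y = r * prob p a b X Y"
  by (simp_all add: prob_def lookup_add lookup_scaleR)

lemma box_eqI: "(\<And>a b X Y. prob p a b X Y = prob q a b X Y) \<Longrightarrow> p = q"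
  unfolding prob_def by (auto intro!: poly_mapping_eqI)

text \<open>All constraints other than positivity are affine or linear, so the weights may be
  negative as long as the result stays nonnegative. This allows subtracting a multiple of one box
  from another.\<close>

lemma ns_polytope_affine_combination:
  assumes p: "p \<in> ns_polytope dA dB" and q: "q \<in> ns_polytope dA dB" and "u + v = 1"
    and nonneg: "\<And>a b X Y. 0 \<le> u * prob p a b X Y + v * prob q a b X Y"
  shows "u *\<^sub>R p + v *\<^sub>R q \<in> ns_polytope dA dB"
  unfolding ns_polytope_def mem_Collect_eq prob_linear
proof (intro conjI)
  show "\<forall>a b X Y. u * prob p a b X Y + v * prob q a b X Y \<noteq> 0 \<longrightarrow>
      X \<in> {0, 1} \<and> Y \<in> {0, 1} \<and> a < dA X \<and> b < dB Y"
    using ns_support[OF p] ns_support[OF q] by (metis add_0 mult_zero_right)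
  show "\<forall>X\<in>{0, 1}. \<forall>Y\<in>{0, 1}. \<forall>a<dA X. \<forall>b<dB Y. 0 \<le> u * prob p a b X Y + v * prob q a b X Y"
    using nonneg by blast
  show "\<forall>X\<in>{0, 1}. \<forall>Y\<in>{0, 1}. (\<Sum>a<dA X. \<Sum>b<dB Y. u * prob p a b X Y + v * prob q a b X Y) = 1"
    using ns_total[OF p] ns_total[OF q] \<open>u + v = 1\<close>
    by (simp only: sum.distrib sum_distrib_left[symmetric]) simp
  show "\<forall>X\<in>{0, 1}. \<forall>a<dA X. \<forall>Y\<in>{0, 1}. \<forall>Y'\<in>{0, 1}.
      (\<Sum>b<dB Y. u * prob p a b X Y + v * prob q a b X Y) =
      (\<Sum>b<dB Y'. u * prob p a b X Y' + v * prob q a b X Y')"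
    unfolding sum.distrib sum_distrib_left[symmetric]
    using ns_Alice[OF p] ns_Alice[OF q] by (metis (no_types, lifting))
  show "\<forall>Y\<in>{0, 1}. \<forall>b<dB Y. \<forall>X\<in>{0, 1}. \<forall>X'\<in>{0, 1}.
      (\<Sum>a<dA X. u * prob p a b X Y + v * prob q a b X Y) =
      (\<Sum>a<dA X'. u * prob p a b X' Y + v * prob q a b X' Y)"
    unfolding sum.distrib sum_distrib_left[symmetric]
    using ns_Bob[OF p] ns_Bob[OF q] by (metis (no_types, lifting))
qed

lemma prob_le_1:
  assumes "p \<in> ns_polytope dA dB"
  shows "prob p a b X Y \<le> 1"
proof (cases "prob p a b X Y = 0")
  case False
  from ns_support[OF assms this] have r: "X \<in> {0,1}" "Y \<in> {0,1}" "a < dA X" "b < dB Y" by auto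
  note n = ns_nonneg[OF assms]
  have "prob p a b X Y \<le> (\<Sum>b<dB Y. prob p a b X Y)" using r n by (intro member_le_sum) auto
  also have "\<dots> \<le> (\<Sum>a<dA X. \<Sum>b<dB Y. prob p a b X Y)"
    using r n by (intro member_le_sum[where i = a and f = "\<lambda>a. \<Sum>b<dB Y. prob p a b X Y"]) (auto intro: sum_nonneg)
  finally show ?thesis using ns_total[OF assms r(1,2)] by simp
qed simp

subsection \<open>Boxes supported on a single cycle\<close>

text \<open>Written with this form of the congruence rather than via \<^const>\<open>pr_family\<close>, whose condition is
  unsatisfiable at \<open>X = Y = 1\<close> when \<open>k = 1\<close>.\<close>

definition cycle_box :: "(nat \<Rightarrow> nat) \<Rightarrow> (nat \<Rightarrow> nat) \<Rightarrow> nat \<Rightarrow> (nat \<Rightarrow> nat \<Rightarrow> nat) \<Rightarrow> (nat \<Rightarrow> nat \<Rightarrow> nat) \<Rightarrow> box"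
  where "cycle_box dA dB k \<pi> \<rho> = Abs_poly_mapping (\<lambda>(a, b, X, Y).
     if X \<in> {0,1} \<and> Y \<in> {0,1} \<and> a < dA X \<and> b < dB Y \<and> \<pi> X a < k \<and> \<rho> Y b = (\<pi> X a + X * Y) mod k
     then 1 / real k else 0)"

lemma prob_cycle_box:
  "prob (cycle_box dA dB k \<pi> \<rho>) a b X Y =
     (if X \<in> {0,1} \<and> Y \<in> {0,1} \<and> a < dA X \<and> b < dB Y \<and> \<pi> X a < k \<and> \<rho> Y b = (\<pi> X a + X * Y) mod k
      then 1 / real k else 0)"
proof -
  let ?f = "\<lambda>(a, b, X, Y).
     if X \<in> {0,1} \<and> Y \<in> {0,1} \<and> a < dA X \<and> b < dB Y \<and> \<pi> X a < k \<and> \<rho> Y b = (\<pi> X a + X * Y) mod k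
     then 1 / real k else 0"
  have "{x. ?f x \<noteq> 0} \<subseteq> {..<dA 0 + dA 1} \<times> {..<dB 0 + dB 1} \<times> {0,1} \<times> {0,1}"
    by (auto split: if_splits)
  then have "finite {x. ?f x \<noteq> 0}" by (rule finite_subset) simp
  then have "Poly_Mapping.lookup (cycle_box dA dB k \<pi> \<rho>) = ?f"
    unfolding cycle_box_def by (subst Abs_poly_mapping_inverse) auto
  then show ?thesis unfolding prob_def by simp
qed

text \<open>For each input pair the box is uniform on a matching of the labels below
  \<open>k\<close>. Either party's marginal is therefore \<open>1 / k\<close> on those labels,
  whatever the other input is.\<close>

lemma cycle_box_in_ns_polytope:
  assumes k: "0 < k" "\<And>X. X \<in> {0,1} \<Longrightarrow> k \<le> dA X" "\<And>Y. Y \<in> {0,1} \<Longrightarrow> k \<le> dB Y"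
    and \<pi>: "\<And>X. X \<in> {0,1} \<Longrightarrow> \<pi> X permutes {..<dA X}"
    and \<rho>: "\<And>Y. Y \<in> {0,1} \<Longrightarrow> \<rho> Y permutes {..<dB Y}"
  shows "cycle_box dA dB k \<pi> \<rho> \<in> ns_polytope dA dB"
proof -
  let ?c = "cycle_box dA dB k \<pi> \<rho>"
  have Alice: "(\<Sum>b<dB Y. prob ?c a b X Y) = (if \<pi> X a < k then 1 / real k else 0)"
    if "X \<in> {0,1}" "Y \<in> {0,1}" "a < dA X" for a X Y
  proof -
    have "(\<Sum>b<dB Y. prob ?c a b X Y) =
        (\<Sum>b<dB Y. (\<lambda>j. if \<pi> X a < k \<and> j = (\<pi> X a + X * Y) mod k then 1 / real k else 0) (\<rho> Y b))"
      using that by (intro sum.cong) (auto simp: prob_cycle_box)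
    also have "\<dots> = (\<Sum>j<dB Y. if \<pi> X a < k \<and> j = (\<pi> X a + X * Y) mod k then 1 / real k else 0)"
      using sum.permute[OF \<rho>[OF that(2)]] by (metis (no_types, lifting) comp_apply sum.cong)
    also have "\<dots> = (if \<pi> X a < k then 1 / real k else 0)"
    proof -
      have "(\<pi> X a + X * Y) mod k < dB Y"
        using k(1) k(3)[OF that(2)] by (meson mod_less_divisor order_less_le_trans)
      then show ?thesis by simp
    qed
    finally show ?thesis .
  qed
  have Bob: "(\<Sum>a<dA X. prob ?c a b X Y) = (if \<rho> Y b < k then 1 / real k else 0)"
    if "X \<in> {0,1}" "Y \<in> {0,1}" "b < dB Y" for b X Y
  proof -
    have "(\<Sum>a<dA X. prob ?c a b X Y) =
        (\<Sum>a<dA X. (\<lambda>i. if i < k \<and> \<rho> Y b = (i + X * Y) mod k then 1 / real k else 0) (\<pi> X a))"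
      using that by (intro sum.cong) (auto simp: prob_cycle_box)
    also have "\<dots> = (\<Sum>i<dA X. if i < k \<and> \<rho> Y b = (i + X * Y) mod k then 1 / real k else 0)"
      using sum.permute[OF \<pi>[OF that(1)]] by (metis (no_types, lifting) comp_apply sum.cong)
    also have "\<dots> = (if \<rho> Y b < k then 1 / real k else 0)"
      using k(1) k(2)[OF that(1)] by (rule sum_shift_mod_indicator)
    finally show ?thesis .
  qed
  have total: "(\<Sum>a<dA X. \<Sum>b<dB Y. prob ?c a b X Y) = 1" if "X \<in> {0,1}" "Y \<in> {0,1}" for X Y
  proof -
    have "(\<Sum>a<dA X. \<Sum>b<dB Y. prob ?c a b X Y) = (\<Sum>a<dA X. (\<lambda>i. if i < k then 1 / real k else 0) (\<pi> X a))"
      using Alice that by (intro sum.cong) auto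
    also have "\<dots> = (\<Sum>i<dA X. if i < k then 1 / real k else 0)"
      using sum.permute[OF \<pi>[OF that(1)]] by (metis (no_types, lifting) comp_apply sum.cong)
    also have "\<dots> = (\<Sum>i<k. 1 / real k)"
      using k(2)[OF that(1)] by (intro sum.mono_neutral_cong_right) auto
    finally show ?thesis using k(1) by simp
  qed
  show ?thesis unfolding ns_polytope_def mem_Collect_eq
  proof (intro conjI)
    show "\<forall>a b X Y. prob ?c a b X Y \<noteq> 0 \<longrightarrow> X \<in> {0, 1} \<and> Y \<in> {0, 1} \<and> a < dA X \<and> b < dB Y"
      unfolding prob_cycle_box by (auto split: if_splits)
    show "\<forall>X\<in>{0, 1}. \<forall>Y\<in>{0, 1}. \<forall>a<dA X. \<forall>b<dB Y. 0 \<le> prob ?c a b X Y"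
      unfolding prob_cycle_box by simp
    show "\<forall>X\<in>{0, 1}. \<forall>Y\<in>{0, 1}. (\<Sum>a<dA X. \<Sum>b<dB Y. prob ?c a b X Y) = 1"
      using total by blast
    show "\<forall>X\<in>{0, 1}. \<forall>a<dA X. \<forall>Y\<in>{0, 1}. \<forall>Y'\<in>{0, 1}.
        (\<Sum>b<dB Y. prob ?c a b X Y) = (\<Sum>b<dB Y'. prob ?c a b X Y')"
      using Alice by (metis (no_types, lifting))
    show "\<forall>Y\<in>{0, 1}. \<forall>b<dB Y. \<forall>X\<in>{0, 1}. \<forall>X'\<in>{0, 1}.
        (\<Sum>a<dA X. prob ?c a b X Y) = (\<Sum>a<dA X'. prob ?c a b X' Y)"
      using Bob by (metis (no_types, lifting))
  qed
qed

text \<open>A periodic orbit of the map that goes once around the four layers is automatically simple in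
  every layer: each layer's part of the orbit determines the next layer's.\<close>

lemma exists_cycle_in_support:
  assumes p: "p \<in> ns_polytope dA dB"
  obtains k \<alpha> \<beta> where "0 < k"
    "\<And>X. X \<in> {0,1} \<Longrightarrow> inj_on (\<alpha> X) {..<k}" "\<And>Y. Y \<in> {0,1} \<Longrightarrow> inj_on (\<beta> Y) {..<k}"
    "\<And>X Y i. X \<in> {0,1} \<Longrightarrow> Y \<in> {0,1} \<Longrightarrow> i < k \<Longrightarrow> 0 < prob p (\<alpha> X i) (\<beta> Y ((i + X * Y) mod k)) X Y"
proof -
  define pos where "pos a b X Y \<longleftrightarrow> 0 < prob p a b X Y" for a b X Y
  have pos_support: "X \<in> {0,1}" "Y \<in> {0,1}" "a < dA X" "b < dB Y" if "pos a b X Y" for a b X Y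
    using ns_support[OF p, of a b X Y] that by (auto simp: pos_def)
  have next_b: "\<exists>b'. pos a b' X Y'" if "pos a b X Y" "Y' \<in> {0,1}" for a b X Y Y'
  proof -
    have "0 < (\<Sum>b<dB Y. prob p a b X Y)"
      using that(1) pos_support[OF that(1)] ns_nonneg[OF p] by (intro sum_pos2[where i = b]) (auto simp: pos_def)
    also have "\<dots> = (\<Sum>b<dB Y'. prob p a b X Y')"
      using pos_support[OF that(1)] that(2) by (intro ns_Alice[OF p])
    finally have "\<not> (\<forall>b\<in>{..<dB Y'}. prob p a b X Y' = 0)"
      by (metis less_irrefl sum.neutral)
    then show ?thesis using ns_nonneg[OF p] by (auto simp: pos_def less_le)
  qed
  have next_a: "\<exists>a'. pos a' b X' Y" if "pos a b X Y" "X' \<in> {0,1}" for a b X X' Y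
  proof -
    have "0 < (\<Sum>a<dA X. prob p a b X Y)"
      using that(1) pos_support[OF that(1)] ns_nonneg[OF p] by (intro sum_pos2[where i = a]) (auto simp: pos_def)
    also have "\<dots> = (\<Sum>a<dA X'. prob p a b X' Y)"
      using pos_support[OF that(1)] that(2) by (intro ns_Bob[OF p])
    finally have "\<not> (\<forall>a\<in>{..<dA X'}. prob p a b X' Y = 0)"
      by (metis less_irrefl sum.neutral)
    then show ?thesis using ns_nonneg[OF p] by (auto simp: pos_def less_le)
  qed
  \<comment> \<open>One fixed choice of successor per outcome, along the layers
    \<open>B\<^sub>1\<close>, \<open>A\<^sub>0\<close>, \<open>B\<^sub>0\<close>,
    \<open>A\<^sub>1\<close> and back to \<open>B\<^sub>1\<close>. Since a successor depends on the
    current outcome alone, outcomes that coincide have coinciding continuations.\<close>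
  define f where "f b = (SOME a. pos a b 0 1)" for b
  define g where "g a = (SOME b. pos a b 0 0)" for a
  define h where "h b = (SOME a. pos a b 1 0)" for b
  define e where "e a = (SOME b. pos a b 1 1)" for a
  define S where "S = {b. \<exists>a. pos a b 0 1}"
  have f: "pos (f b) b 0 1" if "b \<in> S" for b
    using that unfolding f_def S_def by (auto intro: someI)
  have g: "pos (f b) (g (f b)) 0 0" if "b \<in> S" for b
    using next_b[OF f[OF that], of 0] unfolding g_def by (auto intro: someI)
  have h: "pos (h (g (f b))) (g (f b)) 1 0" if "b \<in> S" for b
    using next_a[OF g[OF that], of 1] unfolding h_def by (auto intro: someI)
  have e: "pos (h (g (f b))) (e (h (g (f b)))) 1 1" if "b \<in> S" for b
    using next_b[OF h[OF that], of 1] unfolding e_def by (auto intro: someI)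
  define F where "F b = e (h (g (f b)))" for b
  have FS: "F b \<in> S" if "b \<in> S" for b
    using next_a[OF e[OF that], of 0] unfolding F_def S_def by auto
  have "(\<Sum>a<dA 0. \<Sum>b<dB 1. prob p a b 0 1) \<noteq> 0"
    using ns_total[OF p, of 0 1] by simp
  then obtain a where "(\<Sum>b<dB 1. prob p a b 0 1) \<noteq> 0"
    by (meson sum.not_neutral_contains_not_neutral)
  then obtain b where "prob p a b 0 1 \<noteq> 0"
    by (meson sum.not_neutral_contains_not_neutral)
  then have "b \<in> S" using ns_nonneg[OF p, of a b 0 1] by (auto simp: S_def pos_def less_le)
  moreover have "S \<subseteq> {..<dB 1}" using pos_support(4) by (auto simp: S_def)
  then have "finite S" by (rule finite_subset) simp
  ultimately obtain x k where x: "x \<in> S" "0 < k" "(F ^^ k) x = x" "inj_on (\<lambda>i. (F ^^ i) x) {..<k}"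
    using FS by (metis exists_periodic_point)
  define z where "z i = (F ^^ i) x" for i
  have zS: "z i \<in> S" for i using x(1) FS by (induction i) (auto simp: z_def)
  have F_z: "F (z i) = z ((i + 1) mod k)" if "i < k" for i
    using that x(3) by (cases "i + 1 = k") (auto simp: z_def)
  have inj_shift: "i = j" if "i < k" "j < k" "F (z i) = F (z j)" for i j
  proof -
    have "(i + 1) mod k = (j + 1) mod k"
      using inj_onD[OF x(4), of "(i + 1) mod k" "(j + 1) mod k"] that F_z x(2) by (simp add: z_def)
    then show ?thesis using that shift_mod_inj by blast
  qed
  \<comment> \<open>The index counts turns, each starting in \<open>B\<^sub>1\<close>. Only the edge
    from \<open>A\<^sub>1\<close> to \<open>B\<^sub>1\<close> enters the next turn, which produces
    the shift by \<open>X * Y\<close>.\<close>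
  define \<alpha> where "\<alpha> X i = (if X = 0 then f (z i) else h (g (f (z i))))" for X :: nat and i
  define \<beta> where "\<beta> Y i = (if Y = 0 then g (f (z i)) else z i)" for Y :: nat and i
  show ?thesis
  proof (rule that)
    show "inj_on (\<alpha> X) {..<k}" if "X \<in> {0,1}" for X
      using that inj_shift by (auto simp: \<alpha>_def F_def intro!: inj_onI)
    show "inj_on (\<beta> Y) {..<k}" if "Y \<in> {0,1}" for Y
      using that inj_shift by (auto simp: \<beta>_def F_def intro!: inj_onI)
    show "0 < prob p (\<alpha> X i) (\<beta> Y ((i + X * Y) mod k)) X Y" if "X \<in> {0,1}" "Y \<in> {0,1}" "i < k" for X Y i
      using that f[OF zS[of i]] g[OF zS[of i]] h[OF zS[of i]] e[OF zS[of i]] F_z[OF that(3)]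
      by (auto simp: \<alpha>_def \<beta>_def pos_def F_def)
  qed fact
qed

text \<open>The numberings of the cycle extend to permutations of all outcomes, and the cycle box
  with these labels is supported exactly on the edges of the cycle.\<close>

lemma exists_cycle_box_in_support:
  assumes p: "p \<in> ns_polytope dA dB"
  obtains k \<pi> \<rho> where "0 < k" "\<And>X. X \<in> {0,1} \<Longrightarrow> k \<le> dA X" "\<And>Y. Y \<in> {0,1} \<Longrightarrow> k \<le> dB Y"
    "\<And>X. X \<in> {0,1} \<Longrightarrow> \<pi> X permutes {..<dA X}" "\<And>Y. Y \<in> {0,1} \<Longrightarrow> \<rho> Y permutes {..<dB Y}"
    "\<And>a b X Y. prob (cycle_box dA dB k \<pi> \<rho>) a b X Y \<noteq> 0 \<Longrightarrow> prob p a b X Y \<noteq> 0"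
proof -
  obtain k \<alpha> \<beta> where k: "0 < k"
    and inj: "\<And>X. X \<in> {0,1} \<Longrightarrow> inj_on (\<alpha> X) {..<k}" "\<And>Y. Y \<in> {0,1} \<Longrightarrow> inj_on (\<beta> Y) {..<k}"
    and pos: "\<And>X Y i. X \<in> {0,1} \<Longrightarrow> Y \<in> {0,1} \<Longrightarrow> i < k \<Longrightarrow> 0 < prob p (\<alpha> X i) (\<beta> Y ((i + X * Y) mod k)) X Y"
    using exists_cycle_in_support[OF p] by blast
  have \<alpha>: "\<alpha> X ` {..<k} \<subseteq> {..<dA X}" if "X \<in> {0,1}" for X
  proof
    fix a assume "a \<in> \<alpha> X ` {..<k}"
    then obtain i where i: "i < k" "a = \<alpha> X i" by auto
    \<comment> \<open>Input 0 of the other party makes \<open>X * Y\<close> vanish, so the index is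
      not shifted.\<close>
    then have "0 < prob p a (\<beta> 0 i) X 0" using pos[of X 0 i] that by simp
    then show "a \<in> {..<dA X}" using ns_support[OF p, of a "\<beta> 0 i" X 0] by simp
  qed
  have \<beta>: "\<beta> Y ` {..<k} \<subseteq> {..<dB Y}" if "Y \<in> {0,1}" for Y
  proof
    fix b assume "b \<in> \<beta> Y ` {..<k}"
    then obtain i where i: "i < k" "b = \<beta> Y i" by auto
    then have "0 < prob p (\<alpha> 0 i) b 0 Y" using pos[of 0 Y i] that by simp
    then show "b \<in> {..<dB Y}" using ns_support[OF p, of "\<alpha> 0 i" b 0 Y] by simp
  qed
  have "\<exists>\<pi>. \<pi> permutes {..<dA X} \<and> (\<forall>i<k. \<pi> (\<alpha> X i) = i)" if "X \<in> {0,1}" for X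
    using inj_extends_to_permutation[OF inj(1)[OF that] \<alpha>[OF that]] by blast
  then obtain \<pi> where \<pi>: "\<And>X. X \<in> {0,1} \<Longrightarrow> \<pi> X permutes {..<dA X}"
    "\<And>X i. X \<in> {0,1} \<Longrightarrow> i < k \<Longrightarrow> \<pi> X (\<alpha> X i) = i" by metis
  have "\<exists>\<rho>. \<rho> permutes {..<dB Y} \<and> (\<forall>i<k. \<rho> (\<beta> Y i) = i)" if "Y \<in> {0,1}" for Y
    using inj_extends_to_permutation[OF inj(2)[OF that] \<beta>[OF that]] by blast
  then obtain \<rho> where \<rho>: "\<And>Y. Y \<in> {0,1} \<Longrightarrow> \<rho> Y permutes {..<dB Y}"
    "\<And>Y i. Y \<in> {0,1} \<Longrightarrow> i < k \<Longrightarrow> \<rho> Y (\<beta> Y i) = i" by metis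
  show ?thesis
  proof (rule that[OF k _ _ \<pi>(1) \<rho>(1)])
    show "k \<le> dA X" if "X \<in> {0,1}" for X
      using card_inj_on_le[OF inj(1)[OF that] \<alpha>[OF that]] by simp
    show "k \<le> dB Y" if "Y \<in> {0,1}" for Y
      using card_inj_on_le[OF inj(2)[OF that] \<beta>[OF that]] by simp
    fix a b X Y
    assume "prob (cycle_box dA dB k \<pi> \<rho>) a b X Y \<noteq> 0"
    then have XY: "X \<in> {0,1}" "Y \<in> {0,1}" and i: "\<pi> X a < k" and j: "\<rho> Y b = (\<pi> X a + X * Y) mod k"
      by (auto simp: prob_cycle_box split: if_splits)
    define i j where "i = \<pi> X a" and "j = (i + X * Y) mod k"
    have "\<pi> X (\<alpha> X i) = \<pi> X a" using \<pi>(2)[OF XY(1), of i] i by (simp add: i_def)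
    then have "\<alpha> X i = a" using permutes_inj[OF \<pi>(1)[OF XY(1)]] by (simp add: inj_eq)
    moreover have "\<rho> Y (\<beta> Y j) = \<rho> Y b" using \<rho>(2)[OF XY(2), of j] j k by (simp add: i_def j_def)
    then have "\<beta> Y j = b" using permutes_inj[OF \<rho>(1)[OF XY(2)]] by (simp add: inj_eq)
    ultimately show "prob p a b X Y \<noteq> 0" using pos[OF XY, of i] i by (simp add: i_def j_def)
  qed
qed

text \<open>Otherwise a small multiple of \<open>c\<close> could be split off from \<open>p\<close>.\<close>

lemma extreme_point_eq_if_support_subset:
  assumes p: "p extreme_point_of ns_polytope dA dB" and c: "c \<in> ns_polytope dA dB"
    and supp: "\<And>a b X Y. prob c a b X Y \<noteq> 0 \<Longrightarrow> prob p a b X Y \<noteq> 0"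
  shows "p = c"
proof (rule ccontr)
  assume "p \<noteq> c"
  have pP: "p \<in> ns_polytope dA dB" using p by (simp add: extreme_point_of_def)
  \<comment> \<open>The minimum has to lie below every nonzero entry of \<open>p\<close> and below
    1. Including \<open>1/2\<close> secures the latter, and that \<open>M\<close> is
    nonempty.\<close>
  define M where "M = insert (1/2) (Poly_Mapping.lookup p ` Poly_Mapping.keys p)"
  define \<epsilon> where "\<epsilon> = Min M"
  have M: "finite M" "M \<noteq> {}" by (auto simp: M_def)
  have "0 < x" if "x \<in> M" for x
  proof (cases "x = 1/2")
    case False
    with that have "x \<in> Poly_Mapping.lookup p ` Poly_Mapping.keys p" by (simp add: M_def)
    then obtain y where "x = Poly_Mapping.lookup p y" "y \<in> Poly_Mapping.keys p" by blast
    then have y: "x = Poly_Mapping.lookup p y" "x \<noteq> 0" by (simp_all add: in_keys_iff)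
    obtain a b X Y where "y = (a, b, X, Y)" by (cases y)
    with y have "x = prob p a b X Y" "x \<noteq> 0" by (simp_all add: prob_def)
    then show ?thesis using ns_nonneg[OF pP, of a b X Y] by simp
  qed simp
  then have \<epsilon>0: "0 < \<epsilon>" using M by (simp add: \<epsilon>_def)
  have \<epsilon>1: "\<epsilon> \<le> 1/2" unfolding \<epsilon>_def using M(1) by (rule Min_le) (simp add: M_def)
  have \<epsilon>p: "\<epsilon> * prob c a b X Y \<le> prob p a b X Y" for a b X Y
  proof (cases "prob c a b X Y = 0")
    case True
    then show ?thesis using ns_nonneg[OF pP] by simp
  next
    case False
    then have "prob p a b X Y \<in> M" using supp by (auto simp: M_def prob_def in_keys_iff)
    then have "\<epsilon> \<le> prob p a b X Y" using M by (simp add: \<epsilon>_def)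
    moreover have "\<epsilon> * prob c a b X Y \<le> \<epsilon> * 1"
      using prob_le_1[OF c] \<epsilon>0 by (intro mult_left_mono) auto
    ultimately show ?thesis by simp
  qed
  \<comment> \<open>What remains of \<open>p\<close> after removing \<open>\<epsilon>\<close> times
    \<open>c\<close>, rescaled to total weight 1.\<close>
  define r where "r = (1 / (1 - \<epsilon>)) *\<^sub>R p + (- \<epsilon> / (1 - \<epsilon>)) *\<^sub>R c"
  have rP: "r \<in> ns_polytope dA dB" unfolding r_def
  proof (rule ns_polytope_affine_combination[OF pP c])
    show "1 / (1 - \<epsilon>) + - \<epsilon> / (1 - \<epsilon>) = 1" using \<epsilon>1 by (simp add: field_simps)
    show "0 \<le> 1 / (1 - \<epsilon>) * prob p a b X Y + - \<epsilon> / (1 - \<epsilon>) * prob c a b X Y" for a b X Y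
    proof -
      have "0 \<le> (prob p a b X Y - \<epsilon> * prob c a b X Y) / (1 - \<epsilon>)"
        using \<epsilon>p[of a b X Y] \<epsilon>1 by simp
      then show ?thesis by (simp add: diff_divide_distrib)
    qed
  qed
  have p_eq: "p = (1 - \<epsilon>) *\<^sub>R r + \<epsilon> *\<^sub>R c"
  proof -
    have "(1 - \<epsilon>) *\<^sub>R r = p - \<epsilon> *\<^sub>R c" using \<epsilon>1 by (simp add: r_def scaleR_right_diff_distrib)
    then show ?thesis by simp
  qed
  have "(1 - \<epsilon>) *\<^sub>R c + \<epsilon> *\<^sub>R c = c" by (simp add: scaleR_left_diff_distrib)
  then have "r \<noteq> c" using p_eq \<open>p \<noteq> c\<close> by metis
  then have "p \<in> open_segment r c"
    using p_eq \<epsilon>0 \<epsilon>1 unfolding in_segment by (intro conjI exI[of _ \<epsilon>]) auto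
  then show False using p rP c by (auto simp: extreme_point_of_def)
qed

text \<open>Modulo 1 the shift disappears: each party outputs the outcome labelled 0 with certainty,
  so a single deterministic strategy suffices.\<close>

lemma cycle_box_1_local:
  assumes d: "\<And>X. X \<in> {0,1} \<Longrightarrow> 1 \<le> dA X" "\<And>Y. Y \<in> {0,1} \<Longrightarrow> 1 \<le> dB Y"
    and \<pi>: "\<And>X. X \<in> {0,1} \<Longrightarrow> \<pi> X permutes {..<dA X}"
    and \<rho>: "\<And>Y. Y \<in> {0,1} \<Longrightarrow> \<rho> Y permutes {..<dB Y}"
  shows "local_box dA dB (cycle_box dA dB 1 \<pi> \<rho>)"
proof -
  have pv: "prob_vector n (\<lambda>i. if \<theta> i = 0 then 1 else 0)" if "1 \<le> n" "\<theta> permutes {..<n}" for n and \<theta> :: "nat \<Rightarrow> nat"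
  proof -
    have "(\<Sum>i<n. if \<theta> i = 0 then 1 else 0) = (\<Sum>i<n. if i = 0 then 1 else (0::real))"
      using sum.permute[OF that(2), of "\<lambda>i. if i = 0 then 1 else (0::real)"] by (simp add: o_def)
    then show ?thesis using that(1) by (simp add: prob_vector_def)
  qed
  show ?thesis unfolding local_box_def
  proof (intro exI conjI)
    show "prob_vector (Suc 0) (\<lambda>_. 1)" by (simp add: prob_vector_def)
    show "\<forall>l<Suc 0. \<forall>X\<in>{0,1}. prob_vector (dA X) ((\<lambda>_ X a. if \<pi> X a = 0 then 1 else 0) l X)"
      using pv d(1) \<pi> by blast
    show "\<forall>l<Suc 0. \<forall>Y\<in>{0,1}. prob_vector (dB Y) ((\<lambda>_ Y b. if \<rho> Y b = 0 then 1 else 0) l Y)"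
      using pv d(2) \<rho> by blast
    show "\<forall>X\<in>{0, 1}. \<forall>Y\<in>{0, 1}. \<forall>a<dA X. \<forall>b<dB Y. prob (cycle_box dA dB 1 \<pi> \<rho>) a b X Y =
      (\<Sum>l<Suc 0. 1 * (\<lambda>_ X a. if \<pi> X a = 0 then 1 else 0) l X a * (\<lambda>_ Y b. if \<rho> Y b = 0 then 1 else 0) l Y b)"
      by (simp add: prob_cycle_box)
  qed
qed

subsection \<open>Circulations supported on a single cycle\<close>

text \<open>By no-signalling, the flow along consecutive edges of the cycle is the same.\<close>

lemma constant_on_cycle:
  assumes x: "x \<in> ns_polytope dA dB" and k: "0 < k"
    and s: "\<And>X. X \<in> {0,1} \<Longrightarrow> s X \<in> {0,1::nat}" and t: "\<And>Y. Y \<in> {0,1} \<Longrightarrow> t Y \<in> {0,1::nat}"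
    and \<alpha>: "\<And>X. X \<in> {0,1} \<Longrightarrow> inj_on (\<alpha> X) {..<k}" "\<And>X i. X \<in> {0,1} \<Longrightarrow> i < k \<Longrightarrow> \<alpha> X i < dA (s X)"
    and \<beta>: "\<And>Y. Y \<in> {0,1} \<Longrightarrow> inj_on (\<beta> Y) {..<k}" "\<And>Y i. Y \<in> {0,1} \<Longrightarrow> i < k \<Longrightarrow> \<beta> Y i < dB (t Y)"
    and supp: "\<And>X Y a b. \<lbrakk>X \<in> {0,1}; Y \<in> {0,1}; prob x a b (s X) (t Y) \<noteq> 0\<rbrakk> \<Longrightarrow>
        \<exists>i<k. a = \<alpha> X i \<and> b = \<beta> Y ((i + X * Y) mod k)"
    and XY: "X \<in> {0,1}" "Y \<in> {0,1}" and i: "i < k"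
  shows "prob x (\<alpha> X i) (\<beta> Y ((i + X * Y) mod k)) (s X) (t Y) = 1 / real k"
proof -
  define f where "f X Y i = prob x (\<alpha> X i) (\<beta> Y ((i + X * Y) mod k)) (s X) (t Y)" for X Y i
  \<comment> \<open>On a simple cycle an outcome has only one edge to each neighbouring layer, so
    each marginal is a single edge weight.\<close>
  have Alice: "(\<Sum>b<dB (t Y). prob x (\<alpha> X i) b (s X) (t Y)) = f X Y i"
    if XY: "X \<in> {0,1}" "Y \<in> {0,1}" and i: "i < k" for X Y i
  proof -
    have "prob x (\<alpha> X i) b (s X) (t Y) = 0" if "b \<noteq> \<beta> Y ((i + X * Y) mod k)" for b
      using supp[OF XY, of "\<alpha> X i" b] that i inj_onD[OF \<alpha>(1)[OF XY(1)]] by force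
    then have "(\<Sum>b<dB (t Y). prob x (\<alpha> X i) b (s X) (t Y)) =
        (\<Sum>b\<in>{\<beta> Y ((i + X * Y) mod k)}. prob x (\<alpha> X i) b (s X) (t Y))"
      using \<beta>(2)[OF XY(2)] k by (intro sum.mono_neutral_right) auto
    then show ?thesis by (simp add: f_def)
  qed
  have Bob: "(\<Sum>a<dA (s X). prob x a (\<beta> Y ((i + X * Y) mod k)) (s X) (t Y)) = f X Y i"
    if XY: "X \<in> {0,1}" "Y \<in> {0,1}" and i: "i < k" for X Y i
  proof -
    have "prob x a (\<beta> Y ((i + X * Y) mod k)) (s X) (t Y) = 0" if "a \<noteq> \<alpha> X i" for a
    proof (rule ccontr)
      assume "\<not> ?thesis"
      then obtain j where j: "j < k" "a = \<alpha> X j" "\<beta> Y ((i + X * Y) mod k) = \<beta> Y ((j + X * Y) mod k)"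
        using supp[OF XY] by blast
      then have "(i + X * Y) mod k = (j + X * Y) mod k"
        using inj_onD[OF \<beta>(1)[OF XY(2)]] k by simp
      then have "i = j" using shift_mod_inj i j(1) by blast
      then show False using j(2) that by simp
    qed
    then have "(\<Sum>a<dA (s X). prob x a (\<beta> Y ((i + X * Y) mod k)) (s X) (t Y)) =
        (\<Sum>a\<in>{\<alpha> X i}. prob x a (\<beta> Y ((i + X * Y) mod k)) (s X) (t Y))"
      using \<alpha>(2)[OF XY(1) i] by (intro sum.mono_neutral_right) auto
    then show ?thesis by (simp add: f_def)
  qed
  have f_Y: "f X 0 i = f X 1 i" if "X \<in> {0,1}" "i < k" for X i
    using ns_Alice[OF x s[OF that(1)] t[of 0] t[of 1], of "\<alpha> X i"]
      Alice[OF that(1) _ that(2), of 0] Alice[OF that(1) _ that(2), of 1] by simp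
  have f_0: "f 0 0 i = f 1 0 i" if "i < k" for i
    using ns_Bob[OF x t[of 0] s[of 0] s[of 1], of "\<beta> 0 i"] Bob[of 0 0 i] Bob[of 1 0 i] that by simp
  \<comment> \<open>Bob's outcome with index \<open>i + 1\<close> is met by Alice's index
    \<open>i + 1\<close> at \<open>X = 0\<close>, but by her index \<open>i\<close> at
    \<open>X = 1\<close>.\<close>
  have f_1: "f 0 1 ((i + 1) mod k) = f 1 1 i" if "i < k" for i
    using ns_Bob[OF x t[of 1] s[of 0] s[of 1], of "\<beta> 1 ((i + 1) mod k)"]
      Bob[of 0 1 "(i + 1) mod k"] Bob[of 1 1 i] that k by simp
  have const: "f 0 0 i = f 0 0 0" if "i < k" for i
    using that
  proof (induction i)
    case (Suc i)
    \<comment> \<open>One turn backwards along the cycle: the input pairs (0,0), (0,1), (1,1), (1,0)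
      and again (0,0), with the index dropping between (0,1) and (1,1).\<close>
    then have "f 0 0 (Suc i) = f 0 0 i"
      using f_Y[of 0 "Suc i"] f_1[of i] f_Y[of 1 i] f_0[of i] by simp
    then show ?case using Suc by simp
  qed simp
  have f_XY: "f X Y i = f 0 0 0" if "X \<in> {0,1}" "Y \<in> {0,1}" "i < k" for X Y i
    using that f_Y[of 0 i] f_Y[of 1 i] f_0[of i] const[of i] by auto
  have zero: "(\<Sum>b<dB (t 0). prob x a b (s 0) (t 0)) = 0" if "a \<notin> \<alpha> 0 ` {..<k}" for a
    using supp[of 0 0 a] that by (intro sum.neutral) fastforce
  \<comment> \<open>Normalization at one input pair, where the cycle has \<open>k\<close> edges of
    equal weight, fixes the common value.\<close>
  have "1 = (\<Sum>a<dA (s 0). \<Sum>b<dB (t 0). prob x a b (s 0) (t 0))"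
    using ns_total[OF x s[of 0] t[of 0]] by simp
  also have "\<dots> = (\<Sum>a\<in>\<alpha> 0 ` {..<k}. \<Sum>b<dB (t 0). prob x a b (s 0) (t 0))"
    using \<alpha>(2)[of 0] zero by (intro sum.mono_neutral_right) auto
  also have "\<dots> = (\<Sum>i<k. \<Sum>b<dB (t 0). prob x (\<alpha> 0 i) b (s 0) (t 0))"
    using \<alpha>(1)[of 0] by (simp add: sum.reindex)
  also have "\<dots> = (\<Sum>i<k. f 0 0 0)"
  proof (intro sum.cong refl)
    show "(\<Sum>b<dB (t 0). prob x (\<alpha> 0 i) b (s 0) (t 0)) = f 0 0 0" if "i \<in> {..<k}" for i
      using that Alice[of 0 0 i] const[of i] by simp
  qed
  finally have "f 0 0 0 = 1 / real k" using k by (simp add: field_simps)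
  then show ?thesis using f_XY[OF XY i] by (simp add: f_def)
qed

lemma permutes_pair_mem: "\<sigma> permutes {0,1::nat} \<Longrightarrow> X \<in> {0,1} \<Longrightarrow> \<sigma> X \<in> {0,1}"
  by (simp only: permutes_in_image)

text \<open>The support of \<open>p\<close> lies on one simple cycle, hence so does that of
  \<open>x\<close>, and a circulation on a cycle is determined by its total flow.\<close>

lemma eq_if_support_in_pr_box:
  assumes k: "k \<in> {2..Min {dA 0, dA 1, dB 0, dB 1}}"
    and p: "p \<in> ns_polytope dA dB" and eqv: "relabelling_equivalent dA dB p (pr_family k)"
    and x: "x \<in> ns_polytope dA dB" and supp: "\<And>a b X Y. prob x a b X Y \<noteq> 0 \<Longrightarrow> prob p a b X Y \<noteq> 0"
  shows "x = p"
proof -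
  obtain \<sigma> \<tau> \<pi> \<rho> where \<sigma>: "\<sigma> permutes {0,1}" and \<tau>: "\<tau> permutes {0,1}"
    and \<pi>: "\<And>X. X \<in> {0,1} \<Longrightarrow> \<pi> X permutes {..<dA X}"
    and \<rho>: "\<And>Y. Y \<in> {0,1} \<Longrightarrow> \<rho> Y permutes {..<dB Y}"
    and pq: "\<And>X Y a b. \<lbrakk>X \<in> {0,1}; Y \<in> {0,1}; a < dA X; b < dB Y\<rbrakk> \<Longrightarrow>
       prob p a b X Y = pr_family k (\<pi> X a) (\<rho> Y b) (\<sigma> X) (\<tau> Y)"
    using eqv unfolding relabelling_equivalent_def by blast
  have k2: "2 \<le> k" and kA: "\<And>X. X \<in> {0,1} \<Longrightarrow> k \<le> dA X" and kB: "\<And>Y. Y \<in> {0,1} \<Longrightarrow> k \<le> dB Y"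
    using k by auto
  \<comment> \<open>The relabelling is inverted to describe the cycle in the inputs and outcomes of
    \<open>p\<close> itself: \<open>\<alpha> X i\<close> is the outcome at input \<open>s X\<close>
    that carries label \<open>i\<close>.\<close>
  define s where "s = inv \<sigma>"
  define t where "t = inv \<tau>"
  have s: "s X \<in> {0,1}" "\<sigma> (s X) = X" if "X \<in> {0,1}" for X
    using that permutes_pair_mem[OF permutes_inv[OF \<sigma>]] permutes_inverses(1)[OF \<sigma>] by (auto simp: s_def)
  have t: "t Y \<in> {0,1}" "\<tau> (t Y) = Y" if "Y \<in> {0,1}" for Y
    using that permutes_pair_mem[OF permutes_inv[OF \<tau>]] permutes_inverses(1)[OF \<tau>] by (auto simp: t_def)
  define \<alpha> where "\<alpha> X = inv (\<pi> (s X))" for X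
  define \<beta> where "\<beta> Y = inv (\<rho> (t Y))" for Y
  have inj: "inj_on (\<alpha> X) {..<k}" if "X \<in> {0,1}" for X
    using permutes_inj_on[OF permutes_inv[OF \<pi>[OF s(1)[OF that]]]] by (simp add: \<alpha>_def)
  have inj': "inj_on (\<beta> Y) {..<k}" if "Y \<in> {0,1}" for Y
    using permutes_inj_on[OF permutes_inv[OF \<rho>[OF t(1)[OF that]]]] by (simp add: \<beta>_def)
  have range: "\<alpha> X i < dA (s X)" if "X \<in> {0,1}" "i < k" for X i
    using permutes_in_image[OF permutes_inv[OF \<pi>[OF s(1)[OF that(1)]]], of i] kA[OF s(1)[OF that(1)]] that(2)
    by (simp add: \<alpha>_def)
  have range': "\<beta> Y i < dB (t Y)" if "Y \<in> {0,1}" "i < k" for Y i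
    using permutes_in_image[OF permutes_inv[OF \<rho>[OF t(1)[OF that(1)]]], of i] kB[OF t(1)[OF that(1)]] that(2)
    by (simp add: \<beta>_def)
  have p_supp: "\<exists>i<k. a = \<alpha> X i \<and> b = \<beta> Y ((i + X * Y) mod k)"
    if XY: "X \<in> {0,1}" "Y \<in> {0,1}" and nz: "prob p a b (s X) (t Y) \<noteq> 0" for X Y a b
  proof -
    from ns_support[OF p nz] have ab: "a < dA (s X)" "b < dB (t Y)" by auto
    have "pr_family k (\<pi> (s X) a) (\<rho> (t Y) b) X Y \<noteq> 0"
      using nz pq[OF s(1)[OF XY(1)] t(1)[OF XY(2)] ab] s(2)[OF XY(1)] t(2)[OF XY(2)] by simp
    then have i: "\<pi> (s X) a < k" and j: "\<rho> (t Y) b = (\<pi> (s X) a + X * Y) mod k"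
      using pr_family_eq[OF k2 XY] by (auto split: if_splits)
    have "a = \<alpha> X (\<pi> (s X) a)"
      using permutes_inverses(2)[OF \<pi>[OF s(1)[OF XY(1)]]] by (simp add: \<alpha>_def)
    moreover have "b = \<beta> Y (\<rho> (t Y) b)"
      using permutes_inverses(2)[OF \<rho>[OF t(1)[OF XY(2)]]] by (simp add: \<beta>_def)
    ultimately show ?thesis using i j by (metis)
  qed
  \<comment> \<open>Applied to \<open>p\<close> as well as to \<open>x\<close>, so that both are
    known to equal \<open>1 / k\<close> on the cycle.\<close>
  have val: "prob y (\<alpha> X i) (\<beta> Y ((i + X * Y) mod k)) (s X) (t Y) = 1 / real k"
    if "y \<in> {x, p}" "X \<in> {0,1}" "Y \<in> {0,1}" "i < k" for y X Y i
  proof (rule constant_on_cycle[where dA = dA and dB = dB and s = s and t = t and \<alpha> = \<alpha> and \<beta> = \<beta>])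
    show "y \<in> ns_polytope dA dB" "0 < k" using that p x by auto
    show "\<exists>i<k. a = \<alpha> X i \<and> b = \<beta> Y ((i + X * Y) mod k)"
      if "X \<in> {0,1}" "Y \<in> {0,1}" "prob y a b (s X) (t Y) \<noteq> 0" for X Y a b
      using that \<open>y \<in> {x, p}\<close> supp p_supp by blast
  qed (use that s(1) t(1) inj inj' range range' in simp_all)
  show ?thesis
  proof (rule box_eqI)
    fix a b X Y
    show "prob x a b X Y = prob p a b X Y"
    proof (cases "prob p a b X Y = 0")
      case True
      then show ?thesis using supp[of a b X Y] by metis
    next
      case False
      then have XY: "X \<in> {0,1}" "Y \<in> {0,1}" using ns_support[OF p] by blast+
      have eq: "s (\<sigma> X) = X" "t (\<tau> Y) = Y"
        using permutes_inverses(2)[OF \<sigma>] permutes_inverses(2)[OF \<tau>] by (simp_all add: s_def t_def)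
      have mem: "\<sigma> X \<in> {0,1}" "\<tau> Y \<in> {0,1}" using permutes_pair_mem[OF \<sigma> XY(1)] permutes_pair_mem[OF \<tau> XY(2)] .
      from p_supp[OF mem] False eq obtain i
        where "i < k" "a = \<alpha> (\<sigma> X) i" "b = \<beta> (\<tau> Y) ((i + \<sigma> X * \<tau> Y) mod k)" by auto
      then show ?thesis using val[OF _ mem, of x i] val[OF _ mem, of p i] eq by simp
    qed
  qed
qed

text \<open>In a proper convex combination of nonnegative entries nothing cancels, so both endpoints
  have their support inside that of \<open>p\<close> and hence equal \<open>p\<close>.\<close>

lemma pr_box_extreme:
  assumes k: "k \<in> {2..Min {dA 0, dA 1, dB 0, dB 1}}"
    and p: "p \<in> ns_polytope dA dB" and eqv: "relabelling_equivalent dA dB p (pr_family k)"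
  shows "p extreme_point_of ns_polytope dA dB"
  unfolding extreme_point_of_def
proof (intro conjI ballI notI)
  fix x y assume x: "x \<in> ns_polytope dA dB" and y: "y \<in> ns_polytope dA dB" and "p \<in> open_segment x y"
  then obtain u where u: "x \<noteq> y" "0 < u" "u < 1" "p = (1 - u) *\<^sub>R x + u *\<^sub>R y"
    by (auto simp: in_segment)
  have "prob p a b X Y \<noteq> 0" if "prob x a b X Y \<noteq> 0 \<or> prob y a b X Y \<noteq> 0" for a b X Y
  proof -
    have "0 < (1 - u) * prob x a b X Y \<or> 0 < u * prob y a b X Y"
      using that u(2,3) ns_nonneg[OF x, of a b X Y] ns_nonneg[OF y, of a b X Y] by (auto simp: less_le)
    moreover have "0 \<le> (1 - u) * prob x a b X Y" "0 \<le> u * prob y a b X Y"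
      using u(2,3) ns_nonneg[OF x] ns_nonneg[OF y] by simp_all
    ultimately have "0 < (1 - u) * prob x a b X Y + u * prob y a b X Y" by linarith
    then show ?thesis using u(4) by simp
  qed
  then have "x = p" "y = p"
    using eq_if_support_in_pr_box[OF k p eqv x] eq_if_support_in_pr_box[OF k p eqv y] by blast+
  then show False using u(1) by simp
qed (rule p)

subsection \<open>Non-locality and classification\<close>

lemma pr_box_nonlocal:
  assumes k: "2 \<le> k" and eqv: "relabelling_equivalent dA dB p (pr_family k)"
  shows "\<not> local_box dA dB p"
proof
  assume "local_box dA dB p"
  then obtain n w pA pB where w: "prob_vector n w"
    and pA: "\<And>l X. l < n \<Longrightarrow> X \<in> {0,1} \<Longrightarrow> prob_vector (dA X) (pA l X)"
    and pB: "\<And>l Y. l < n \<Longrightarrow> Y \<in> {0,1} \<Longrightarrow> prob_vector (dB Y) (pB l Y)"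
    and p: "\<And>X Y a b. \<lbrakk>X \<in> {0,1}; Y \<in> {0,1}; a < dA X; b < dB Y\<rbrakk> \<Longrightarrow>
        prob p a b X Y = (\<Sum>l<n. w l * pA l X a * pB l Y b)"
    unfolding local_box_def by blast
  have pos: "\<exists>i<m. 0 < v i" if "prob_vector m v" for m and v :: "nat \<Rightarrow> real"
  proof (rule ccontr)
    assume "\<not> ?thesis"
    then have "(\<Sum>i<m. v i) \<le> 0" by (intro sum_nonpos) (meson lessThan_iff not_le)
    then show False using that by (simp add: prob_vector_def)
  qed
  \<comment> \<open>A hidden value of positive weight, and for each input an outcome of positive
    probability under it, form a deterministic strategy inside the support of
    \<open>p\<close>.\<close>
  obtain l where l: "l < n" "0 < w l" using pos[OF w] by blast
  obtain \<alpha> where \<alpha>: "\<And>X. X \<in> {0,1} \<Longrightarrow> \<alpha> X < dA X \<and> 0 < pA l X (\<alpha> X)"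
    using pos[OF pA[OF l(1)]] by metis
  obtain \<beta> where \<beta>: "\<And>Y. Y \<in> {0,1} \<Longrightarrow> \<beta> Y < dB Y \<and> 0 < pB l Y (\<beta> Y)"
    using pos[OF pB[OF l(1)]] by metis
  have p_pos: "0 < prob p (\<alpha> X) (\<beta> Y) X Y" if XY: "X \<in> {0,1}" "Y \<in> {0,1}" for X Y
  proof -
    have "0 < (\<Sum>l<n. w l * pA l X (\<alpha> X) * pB l Y (\<beta> Y))"
    proof (rule sum_pos2)
      show "0 < w l * pA l X (\<alpha> X) * pB l Y (\<beta> Y)" using l(2) \<alpha>[OF XY(1)] \<beta>[OF XY(2)] by simp
      show "0 \<le> w i * pA i X (\<alpha> X) * pB i Y (\<beta> Y)" if "i \<in> {..<n}" for i
        using that w pA[OF _ XY(1), of i] pB[OF _ XY(2), of i] \<alpha>[OF XY(1)] \<beta>[OF XY(2)]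
        by (simp add: prob_vector_def)
    qed (use l in auto)
    then show ?thesis using p XY \<alpha>[OF XY(1)] \<beta>[OF XY(2)] by simp
  qed
  obtain \<sigma> \<tau> and \<pi> \<rho> :: "nat \<Rightarrow> nat \<Rightarrow> nat" where \<sigma>: "\<sigma> permutes {0,1}" and \<tau>: "\<tau> permutes {0,1}"
    and pq: "\<And>X Y a b. \<lbrakk>X \<in> {0,1}; Y \<in> {0,1}; a < dA X; b < dB Y\<rbrakk> \<Longrightarrow>
       prob p a b X Y = pr_family k (\<pi> X a) (\<rho> Y b) (\<sigma> X) (\<tau> Y)"
    using eqv unfolding relabelling_equivalent_def by blast
  define \<alpha>' where "\<alpha>' X = \<pi> (inv \<sigma> X) (\<alpha> (inv \<sigma> X))" for X
  define \<beta>' where "\<beta>' Y = \<rho> (inv \<tau> Y) (\<beta> (inv \<tau> Y))" for Y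
  have rel: "\<alpha>' X < k \<and> \<beta>' Y = (\<alpha>' X + X * Y) mod k" if XY: "X \<in> {0,1}" "Y \<in> {0,1}" for X Y
  proof -
    have st: "inv \<sigma> X \<in> {0,1}" "inv \<tau> Y \<in> {0,1}"
      using permutes_pair_mem[OF permutes_inv[OF \<sigma>] XY(1)] permutes_pair_mem[OF permutes_inv[OF \<tau>] XY(2)] .
    have "pr_family k (\<alpha>' X) (\<beta>' Y) X Y \<noteq> 0"
      using p_pos[OF st] pq[OF st] \<alpha>[OF st(1)] \<beta>[OF st(2)] permutes_inverses(1)[OF \<sigma>] permutes_inverses(1)[OF \<tau>]
      by (simp add: \<alpha>'_def \<beta>'_def)
    then show ?thesis using pr_family_eq[OF k XY] by (auto split: if_splits)
  qed
  \<comment> \<open>The three unshifted input pairs force all labels to be equal, while the pair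
    (1,1) demands a difference of 1 modulo \<open>k\<close>.\<close>
  have "(\<alpha>' 1 + 1) mod k = (\<alpha>' 1 + 0) mod k"
    using rel[of 0 0] rel[of 0 1] rel[of 1 0] rel[of 1 1] by simp
  then have "(1 + \<alpha>' 1) mod k = (0 + \<alpha>' 1) mod k" by (simp add: add.commute)
  then have "(1::nat) = 0" using k shift_mod_inj[of 1 k 0] by simp
  then show False by simp
qed

text \<open>The output permutations are those that define the cycle box. The inputs stay in place,
  since the cycle was numbered so that the shift falls on \<open>X = Y = 1\<close>.\<close>

lemma cycle_box_equivalent:
  assumes k: "2 \<le> k"
    and \<pi>: "\<And>X. X \<in> {0,1} \<Longrightarrow> \<pi> X permutes {..<dA X}"
    and \<rho>: "\<And>Y. Y \<in> {0,1} \<Longrightarrow> \<rho> Y permutes {..<dB Y}"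
  shows "relabelling_equivalent dA dB (cycle_box dA dB k \<pi> \<rho>) (pr_family k)"
  unfolding relabelling_equivalent_def
proof (intro exI conjI)
  show "id permutes {0,1::nat}" "id permutes {0,1::nat}" by (rule permutes_id)+
  show "\<forall>X\<in>{0,1}. \<pi> X permutes {..<dA X}" "\<forall>Y\<in>{0,1}. \<rho> Y permutes {..<dB Y}"
    using \<pi> \<rho> by blast+
  show "\<forall>X\<in>{0,1}. \<forall>Y\<in>{0,1}. \<forall>a<dA X. \<forall>b<dB Y.
      prob (cycle_box dA dB k \<pi> \<rho>) a b X Y = pr_family k (\<pi> X a) (\<rho> Y b) (id X) (id Y)"
    by (intro ballI allI impI) (simp only: prob_cycle_box pr_family_eq[OF k] id_apply simp_thms)
qed

theorem theorem1:
  fixes dA dB :: "nat \<Rightarrow> nat"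
  assumes "dA 0 \<ge> 1" and "dA 1 \<ge> 1" and "dB 0 \<ge> 1" and "dB 1 \<ge> 1"
  shows "{p. p extreme_point_of ns_polytope dA dB \<and> \<not> local_box dA dB p} =
           {p \<in> ns_polytope dA dB.
              \<exists>k\<in>{2..Min {dA 0, dA 1, dB 0, dB 1}}. relabelling_equivalent dA dB p (pr_family k)} \<and>
         (\<forall>k\<in>{2..Min {dA 0, dA 1, dB 0, dB 1}}.
            \<exists>p. p extreme_point_of ns_polytope dA dB \<and> \<not> local_box dA dB p \<and>
                relabelling_equivalent dA dB p (pr_family k))"
proof (intro conjI set_eqI iffI ballI)
  fix p assume "p \<in> {p. p extreme_point_of ns_polytope dA dB \<and> \<not> local_box dA dB p}"
  then have ext: "p extreme_point_of ns_polytope dA dB" and nonloc: "\<not> local_box dA dB p" by auto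
  then have p: "p \<in> ns_polytope dA dB" by (simp add: extreme_point_of_def)
  obtain k \<pi> \<rho> where k: "0 < k" "\<And>X. X \<in> {0,1} \<Longrightarrow> k \<le> dA X" "\<And>Y. Y \<in> {0,1} \<Longrightarrow> k \<le> dB Y"
    and perm: "\<And>X. X \<in> {0,1} \<Longrightarrow> \<pi> X permutes {..<dA X}" "\<And>Y. Y \<in> {0,1} \<Longrightarrow> \<rho> Y permutes {..<dB Y}"
    and supp: "\<And>a b X Y. prob (cycle_box dA dB k \<pi> \<rho>) a b X Y \<noteq> 0 \<Longrightarrow> prob p a b X Y \<noteq> 0"
    using exists_cycle_box_in_support[OF p] by blast
  have p_eq: "p = cycle_box dA dB k \<pi> \<rho>"
    using extreme_point_eq_if_support_subset[OF ext cycle_box_in_ns_polytope[OF k perm] supp] .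
  have "k \<noteq> 1" using nonloc p_eq cycle_box_1_local[of dA dB \<pi> \<rho>] perm assms by fastforce
  then have "2 \<le> k" using k(1) by simp
  then have eqv: "relabelling_equivalent dA dB p (pr_family k)"
    unfolding p_eq using perm by (rule cycle_box_equivalent)
  note \<open>2 \<le> k\<close>
  moreover have "k \<le> Min {dA 0, dA 1, dB 0, dB 1}" using k by simp
  ultimately show "p \<in> {p \<in> ns_polytope dA dB.
      \<exists>k\<in>{2..Min {dA 0, dA 1, dB 0, dB 1}}. relabelling_equivalent dA dB p (pr_family k)}"
    using p eqv by auto
next
  fix p assume "p \<in> {p \<in> ns_polytope dA dB.
      \<exists>k\<in>{2..Min {dA 0, dA 1, dB 0, dB 1}}. relabelling_equivalent dA dB p (pr_family k)}"
  then show "p \<in> {p. p extreme_point_of ns_polytope dA dB \<and> \<not> local_box dA dB p}"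
    using pr_box_extreme pr_box_nonlocal by force
next
  fix k assume k: "k \<in> {2..Min {dA 0, dA 1, dB 0, dB 1}}"
  define p where "p = cycle_box dA dB k (\<lambda>_. id) (\<lambda>_. id)"
  have "p \<in> ns_polytope dA dB"
    unfolding p_def using k by (intro cycle_box_in_ns_polytope) (auto simp: permutes_id)
  moreover have "relabelling_equivalent dA dB p (pr_family k)"
    unfolding p_def using k by (intro cycle_box_equivalent) (auto simp: permutes_id)
  ultimately show "\<exists>p. p extreme_point_of ns_polytope dA dB \<and> \<not> local_box dA dB p \<and>
      relabelling_equivalent dA dB p (pr_family k)"
    using k pr_box_extreme pr_box_nonlocal by (metis atLeastAtMost_iff)
qed

end
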